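(* Let $f,G_i,H_i:\mathbb{R}^n\to\mathbb{R}$ ($i=1,\dots,l$) and $g:\mathbb{R}^n\to\mathbb{R}^m$ be at least twice continuously differentiable. Let $C=\{x\in\mathbb{R}^n: x_{\mathrm l}\le x\le x_{\mathrm u}\}$ and $C^{\mathrm s}=\{s\in\mathbb{R}^{2l}: s_{\mathrm l}\le s\le s_{\mathrm u}\}$ (bounds possibly infinite), where $(s_{\mathrm l})_i=0$ and $(s_{\mathrm l})_{i+l}\le 0$ for $i=1,\dots,l$, and $(s_{\mathrm u})_j\ge 0$ for $j=1,\dots,2l$. Consider the mathematical program with vanishing constraints in vertical form $$\min_{x\in C,\ s\in C^{\mathrm s}} f(x)\quad\text{s.t.}\quad g(x)=0,\quad H_i(x)-s_i=0,\quad G_i(x)-s_{i+l}=0,\quad s_i\ge 0,\quad s_{i+l}s_i\ge 0\qquad(i=1,\dots,l).$$ Then a strong stationary point $(x^*,s^*,y^* )$ of this program is equivalent to an equilibrium point $(x^*,s^*,y^* )$ under the strategy based on piecewise gradient/anti-gradient flows with reduced subproblems described in the context. That is, $(x^*,s^*,y^* )$ is a strong stationary point of the program if and only if it is an equilibrium point under that strategy.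
   Context: **Spaces and cones.** The spaces of the primal variables $x$, of the slacks $s$ (and of the reduced slacks $\tilde s$ below, space $\tilde S$), and of the multipliers $y$ are real finite-dimensional Hilbert spaces with scalar products that need not be Euclidean; those for $x$ and $y$ are written $\langle\cdot,\cdot\rangle_X$ and $\langle\cdot,\cdot\rangle_Y$. $P_M$ is the orthogonal projection onto a convex set $M$ with respect to the scalar product of the primal variables. $T(M,z)$ is the tangent cone of $M$ at $z$ and $T^-(M,z)$ its polar cone. **Lagrangians.** Let $c(x,s)=\big(g(x),(H_i(x)-s_i)_{i=1}^l,(G_i(x)-s_{i+l})_{i=1}^l\big)\in\mathbb{R}^{m+2l}$, $\mathcal L(x,s,y)=f(x)+\langle y,c(x,s)\rangle_Y$, and, for a parameter $\rho\ge0$, $\mathcal L^\rho(x,s,y)=\mathcal L(x,s,y)+\tfrac{\rho}{2}\|c(x,s)\|_Y^2$. **Strong stationarity.** Index sets at a feasible point: $\mathcal I_{00}=\{i:s_i=0,s_{i+l}=0\}$, $\mathcal I_{0+}=\{i:s_i=0,s_{i+l}>0\}$, $\mathcal I_{0-}=\{i:s_i=0,s_{i+l}<0\}$, $\mathcal I_{+0}=\{i:s_i>0,s_{i+l}=0\}$, $\mathcal I_{++}=\{i:s_i>0,s_{i+l}>0\}$, $\mathcal I_0=\mathcal I_{00}\cup\mathcal I_{0+}\cup\mathcal I_{0-}$, $\mathcal I_+=\mathcal I_{+0}\cup\mathcal I_{++}$. The point $(x^*,s^*,y^* )$ is *strong stationary* if $(x^*,s^* )$ is feasible and there are $\eta_H,\eta_G\in\mathbb{R}^l$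 with $$-\nabla_{x,s}\Big[\mathcal L(x,s,y)+\sum_{i=1}^l(\eta_H)_is_i+\sum_{i=1}^l(\eta_G)_is_{i+l}\Big]_{(x^*,s^*,y^* )}\in T^-(C\times C^{\mathrm s},(x^*,s^* )),$$ where $(\eta_H)_i=0$ for $i\in\mathcal I_+$, $(\eta_H)_i\le0$ for $i\in\mathcal I_{00}\cup\mathcal I_{0+}$, $(\eta_H)_i$ is free for $i\in\mathcal I_{0-}$, $(\eta_G)_i=0$ for $i\in\mathcal I_0\cup\mathcal I_{++}$, and $(\eta_G)_i\le0$ for $i\in\mathcal I_{+0}$ (index sets at $s^*$). **Branches.** The upper branch is $C_+(i)=\{s_i\ge0,\ s_{i+l}\ge0\}$ and the lower branch is $C_0(i)=\{s_i=0,\ s_{i+l}\le0\}$. For a signature $\sigma\in\{0,1\}^l$, $C^{\mathrm b}(\sigma)$ is the set of $s\in C^{\mathrm s}$ whose pair $(s_i,s_{i+l})$ lies in $C_+(i)$ if $\sigma_i=1$ and in $C_0(i)$ if $\sigma_i=0$, for every $i$. **Initial signature at a point $x$.** If $H_i(x)>0$: $\sigma_i=1$, $s_i=H_i(x)$, $s_{i+l}=\max\{0,G_i(x)\}$. If $H_i(x)=0$: $s_i=0$, $s_{i+l}=G_i(x)$, and $\sigma_i=1$ if $s_{i+l}>0$, otherwise $\sigma_i=0$. If $H_i(x)<0$: $\sigma_i=0$, $s_i=0$, $s_{i+l}=\min\{0,G_i(x)\}$. **Flow on a piece.** For signature $\sigma$: $$(\dot x,\dot s)=P_{T(C\times C^{\mathrm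 b}(\sigma),(x,s))}\big(-\nabla_{x,s}\mathcal L^\rho(x,s,y)\big),\qquad \dot y=\nabla_y\mathcal L^\rho(x,s,y).$$ **Reduced subproblems (steps along the flow).** For the current signature $\sigma$, the reduced slacks $\tilde s$ consist of $s_1,\dots,s_l$ and those $s_{i+l}$ with $\sigma_i=1$. They are restricted to the set $C^{\mathrm r}(\sigma)$ given by the bounds of $C^{\mathrm s}$ together with $s_i\ge0,\ s_{i+l}\ge0$ if $\sigma_i=1$ and $s_i=0$ if $\sigma_i=0$. The reduced constraint function is $\tilde c(x,\tilde s)=\big(g(x),(H_i(x)-s_i)_{i=1}^l,(G_i(x)-s_{i+l})_{\sigma_i=1}\big)\in\mathbb{R}^r$, $r=m+l+\#\{i:\sigma_i=1\}$; so vanishing constraints in the lower branch are omitted. From the previous iterate $(\hat x,\hat s,\hat y)$, with reduced parts $\tilde{\hat s},\tilde{\hat y}$, and with $\lambda>0$ the inverse step size, one solves $$\min_{x\in C,\ \tilde s\in C^{\mathrm r}(\sigma),\ \tilde w\in\mathbb{R}^r}\ \tilde f^\rho(x,\tilde s)+\lambda\Big[\tfrac12\|x-\hat x\|_X^2+\tfrac12\|\tilde s-\tilde{\hat s}\|_{\tilde S}^2+\tfrac12\|\tilde w-\tilde{\hat y}\|_Y^2\Big]\quad\text{s.t.}\quad \tilde c(x,\tilde s)+\lambda\tilde w=0,$$ with the reduced augmented objective $\tilde f^\rho(x,\tilde s)=f(x)+\tfrac{\rho}{2}\|\tilde c(x,\tilde s)\|_Y^2$. Afterwards, for $\sigma_i=0$,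 $s_{i+l}$ is set to $G_i(x)$ and then projected onto $C^{\mathrm s}\cap C_0(i)$. The new $y$ is $\tilde{\hat y}-\tilde w$ on the retained constraints, and the multiplier of each omitted constraint $G_i(x)-s_{i+l}=0$ ($\sigma_i=0$) is set to zero. **Switching.** If the current point is not strong stationary, put $v=-\nabla_s\mathcal L^\rho(x,s,y)$. For $i$ with $s_i=s_{i+l}=0$: if $\sigma_i=1$, switch to $\sigma_i=0$ when $v_i\le0$ and $v_{i+l}<0$; if $\sigma_i=0$, switch to $\sigma_i=1$ when $v_{i+l}>0$, or when $v_{i+l}=0$ and $v_i>0$. All other signature entries are kept. The flow is then continued from the same point with the new signature. **Equilibrium point under the strategy.** $(x^*,s^*,y^* )$ is an equilibrium point if, for a signature $\sigma$ of the strategy (the one used in the last reduced subproblem) with $(x^*,s^* )\in C\times C^{\mathrm b}(\sigma)$, one has $\dot x=0$, $\dot s=0$, $\dot y=0$ for the flow with signature $\sigma$ at $(x^*,s^*,y^* )$, where by the update rule the multipliers of the vanishing constraints $G_i(x)-s_{i+l}=0$ with $\sigma_i=0$ are zero, and no switch is called for, so that the strategy stays at this point.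
   Formalization: Added, as the claim fails otherwise: a negative s_{i+l} is not at its lower bound; if s_i=s_{i+l}=0, then (s_u)_i>0 or (s_l)_{i+l}=0. Components of v and multipliers are read as scalar products with unit vectors (same signs if coordinates are orthogonal). *)

theory Defs
  imports "HOL-Analysis.Analysis"
begin

definition inner_product :: "('a::real_vector \<Rightarrow> 'a \<Rightarrow> real) \<Rightarrow> bool" where
  "inner_product B \<longleftrightarrow>
     bilinear B \<and> (\<forall>u v. B u v = B v u) \<and> (\<forall>u. u \<noteq> 0 \<longrightarrow> 0 < B u u)"

text \<open>Scalar products are arbitrary (not necessarily the \<open>inner\<close> of the type), so gradient,
  projection and polar cone take the scalar product \<open>B\<close> as an argument.\<close>

definition gradient :: "('a::euclidean_space \<Rightarrow> 'a \<Rightarrow> real) \<Rightarrow> ('a \<Rightarrow> real) \<Rightarrow> 'a \<Rightarrow> 'a" where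
  "gradient B \<phi> z = (THE v. (\<phi> has_derivative (\<lambda>d. B v d)) (at z))"

definition projection :: "('a::euclidean_space \<Rightarrow> 'a \<Rightarrow> real) \<Rightarrow> 'a set \<Rightarrow> 'a \<Rightarrow> 'a" where
  "projection B M z = (SOME p. p \<in> M \<and> (\<forall>q\<in>M. B (z - p) (z - p) \<le> B (z - q) (z - q)))"

text \<open>Bouligand tangent cone.\<close>

definition tangent_cone :: "'a::euclidean_space set \<Rightarrow> 'a \<Rightarrow> 'a set" where
  "tangent_cone M z = {d. \<exists>t e. (\<forall>k. 0 < t k \<and> z + t k *\<^sub>R e k \<in> M) \<and>
     (t :: nat \<Rightarrow> real) \<longlonglongrightarrow> 0 \<and> e \<longlonglongrightarrow> d}"

definition polar_tangent_cone ::
    "('a::euclidean_space \<Rightarrow> 'a \<Rightarrow> real) \<Rightarrow> 'a set \<Rightarrow> 'a \<Rightarrow> 'a set" where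
  "polar_tangent_cone B M z = {w. \<forall>d\<in>tangent_cone M z. B w d \<le> 0}"

definition twice_continuously_differentiable ::
    "('a::real_normed_vector \<Rightarrow> 'b::real_normed_vector) \<Rightarrow> bool" where
  "twice_continuously_differentiable h \<longleftrightarrow>
     (\<exists>(h' :: 'a \<Rightarrow> 'a \<Rightarrow>\<^sub>L 'b) (h'' :: 'a \<Rightarrow> 'a \<Rightarrow>\<^sub>L ('a \<Rightarrow>\<^sub>L 'b)).
        (\<forall>x. (h has_derivative blinfun_apply (h' x)) (at x)) \<and>
        (\<forall>x. (h' has_derivative blinfun_apply (h'' x)) (at x)) \<and>
        continuous_on UNIV h'')"

definition box_set :: "('i::finite \<Rightarrow> ereal) \<Rightarrow> ('i \<Rightarrow> ereal) \<Rightarrow> (real ^ 'i) set" where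
  "box_set lo up = {z. \<forall>j. lo j \<le> ereal (z $ j) \<and> ereal (z $ j) \<le> up j}"

text \<open>Slack vectors have index type \<open>'l + 'l\<close>: the slack \<open>s\<^sub>i\<close> of \<open>H\<^sub>i\<close> is \<open>s $ Inl i\<close>, the slack
  \<open>s\<^sub>i\<^sub>+\<^sub>l\<close> of \<open>G\<^sub>i\<close> is \<open>s $ Inr i\<close>.  Constraints and multipliers have index type \<open>'m + ('l + 'l)\<close>.
  A signature maps \<open>i\<close> to \<open>True\<close> for the upper branch (\<open>\<sigma>\<^sub>i = 1\<close>) and to \<open>False\<close> for the lower
  branch (\<open>\<sigma>\<^sub>i = 0\<close>).  The locale carries no assumptions; it only fixes the problem data.\<close>

locale mpvc =
  fixes f :: "real ^ 'n::finite \<Rightarrow> real"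
    and g :: "real ^ 'n \<Rightarrow> real ^ 'm::finite"
    and H G :: "'l::finite \<Rightarrow> real ^ 'n \<Rightarrow> real"
    and xl xu :: "'n \<Rightarrow> ereal"
    and sl su :: "'l + 'l \<Rightarrow> ereal"
    and ipX :: "real ^ 'n \<Rightarrow> real ^ 'n \<Rightarrow> real"
    and ipS :: "real ^ ('l + 'l) \<Rightarrow> real ^ ('l + 'l) \<Rightarrow> real"
    and ipY :: "real ^ ('m + ('l + 'l)) \<Rightarrow> real ^ ('m + ('l + 'l)) \<Rightarrow> real"
    and \<rho> :: real
begin

definition ipXS :: "(real ^ 'n) \<times> (real ^ ('l + 'l)) \<Rightarrow> (real ^ 'n) \<times> (real ^ ('l + 'l)) \<Rightarrow> real" where
  "ipXS z z' = ipX (fst z) (fst z') + ipS (snd z) (snd z')"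

definition C :: "(real ^ 'n) set" where
  "C = box_set xl xu"

definition Cs :: "(real ^ ('l + 'l)) set" where
  "Cs = box_set sl su"

definition c :: "real ^ 'n \<Rightarrow> real ^ ('l + 'l) \<Rightarrow> real ^ ('m + ('l + 'l))" where
  "c x s = (\<chi> j. case j of Inl k \<Rightarrow> g x $ k
     | Inr (Inl i) \<Rightarrow> H i x - s $ Inl i
     | Inr (Inr i) \<Rightarrow> G i x - s $ Inr i)"

definition lagrangian :: "real ^ 'n \<Rightarrow> real ^ ('l + 'l) \<Rightarrow> real ^ ('m + ('l + 'l)) \<Rightarrow> real" where
  "lagrangian x s y = f x + ipY y (c x s)"

definition aug_lagrangian :: "real ^ 'n \<Rightarrow> real ^ ('l + 'l) \<Rightarrow> real ^ ('m + ('l + 'l)) \<Rightarrow> real" where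
  "aug_lagrangian x s y = lagrangian x s y + \<rho> / 2 * ipY (c x s) (c x s)"

definition feasible :: "real ^ 'n \<Rightarrow> real ^ ('l + 'l) \<Rightarrow> bool" where
  "feasible x s \<longleftrightarrow> x \<in> C \<and> s \<in> Cs \<and> g x = 0 \<and>
     (\<forall>i. H i x - s $ Inl i = 0 \<and> G i x - s $ Inr i = 0 \<and>
          0 \<le> s $ Inl i \<and> 0 \<le> s $ Inr i * s $ Inl i)"

definition I00 :: "real ^ ('l + 'l) \<Rightarrow> 'l set" where
  "I00 s = {i. s $ Inl i = 0 \<and> s $ Inr i = 0}"

definition I0p :: "real ^ ('l + 'l) \<Rightarrow> 'l set" where
  "I0p s = {i. s $ Inl i = 0 \<and> s $ Inr i > 0}"

definition I0m :: "real ^ ('l + 'l) \<Rightarrow> 'l set" where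
  "I0m s = {i. s $ Inl i = 0 \<and> s $ Inr i < 0}"

definition Ip0 :: "real ^ ('l + 'l) \<Rightarrow> 'l set" where
  "Ip0 s = {i. s $ Inl i > 0 \<and> s $ Inr i = 0}"

definition Ipp :: "real ^ ('l + 'l) \<Rightarrow> 'l set" where
  "Ipp s = {i. s $ Inl i > 0 \<and> s $ Inr i > 0}"

definition I0 :: "real ^ ('l + 'l) \<Rightarrow> 'l set" where
  "I0 s = I00 s \<union> I0p s \<union> I0m s"

definition Ip :: "real ^ ('l + 'l) \<Rightarrow> 'l set" where
  "Ip s = Ip0 s \<union> Ipp s"

definition strong_stationary ::
    "real ^ 'n \<Rightarrow> real ^ ('l + 'l) \<Rightarrow> real ^ ('m + ('l + 'l)) \<Rightarrow> bool" where
  "strong_stationary x s y \<longleftrightarrow> feasible x s \<and>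
     (\<exists>\<eta>H \<eta>G :: 'l \<Rightarrow> real.
        - gradient ipXS (\<lambda>(x', s'). lagrangian x' s' y + (\<Sum>i\<in>UNIV. \<eta>H i * s' $ Inl i)
              + (\<Sum>i\<in>UNIV. \<eta>G i * s' $ Inr i)) (x, s)
          \<in> polar_tangent_cone ipXS (C \<times> Cs) (x, s) \<and>
        (\<forall>i\<in>Ip s. \<eta>H i = 0) \<and>
        (\<forall>i\<in>I00 s \<union> I0p s. \<eta>H i \<le> 0) \<and>
        (\<forall>i\<in>I0 s \<union> Ipp s. \<eta>G i = 0) \<and>
        (\<forall>i\<in>Ip0 s. \<eta>G i \<le> 0))"

definition Cb :: "('l \<Rightarrow> bool) \<Rightarrow> (real ^ ('l + 'l)) set" where
  "Cb \<sigma> = {s \<in> Cs. \<forall>i. if \<sigma> i then 0 \<le> s $ Inl i \<and> 0 \<le> s $ Inr i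
                              else s $ Inl i = 0 \<and> s $ Inr i \<le> 0}"

definition flow_xs :: "('l \<Rightarrow> bool) \<Rightarrow> real ^ 'n \<Rightarrow> real ^ ('l + 'l) \<Rightarrow> real ^ ('m + ('l + 'l))
    \<Rightarrow> (real ^ 'n) \<times> (real ^ ('l + 'l))" where
  "flow_xs \<sigma> x s y = projection ipXS (tangent_cone (C \<times> Cb \<sigma>) (x, s))
     (- gradient ipXS (\<lambda>(x', s'). aug_lagrangian x' s' y) (x, s))"

definition flow_y :: "real ^ 'n \<Rightarrow> real ^ ('l + 'l) \<Rightarrow> real ^ ('m + ('l + 'l))
    \<Rightarrow> real ^ ('m + ('l + 'l))" where
  "flow_y x s y = gradient ipY (\<lambda>y'. aug_lagrangian x s y') y"

text \<open>The multiplier of the constraint with index \<open>j\<close> is the coefficient with which that constraint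
  enters the Lagrangian, \<open>\<langle>y, c\<rangle>\<^sub>Y = (\<Sum>j. \<langle>y, e\<^sub>j\<rangle>\<^sub>Y c\<^sub>j)\<close>.  For the Euclidean scalar product this is
  \<open>y $ j\<close>; if \<open>e\<^sub>j\<close> is orthogonal to the other unit vectors, it is a positive multiple of \<open>y $ j\<close>.\<close>

definition multiplier :: "real ^ ('m + ('l + 'l)) \<Rightarrow> 'm + ('l + 'l) \<Rightarrow> real" where
  "multiplier y j = ipY y (axis j 1)"

text \<open>The components of \<open>v = -\<nabla>\<^sub>s L\<^sup>\<rho>\<close> are likewise taken as \<open>v\<^sub>j = \<langle>v, e\<^sub>j\<rangle>\<^sub>S\<close>, the negative partial
  derivative with respect to \<open>s\<^sub>j\<close>; again this is \<open>v $ j\<close> in the Euclidean case and has the same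
  sign as \<open>v $ j\<close> if the slack coordinates are orthogonal.\<close>

definition switch_v :: "real ^ 'n \<Rightarrow> real ^ ('l + 'l) \<Rightarrow> real ^ ('m + ('l + 'l)) \<Rightarrow> 'l + 'l \<Rightarrow> real" where
  "switch_v x s y j = ipS (- gradient ipS (\<lambda>s'. aug_lagrangian x s' y) s) (axis j 1)"

definition next_signature :: "('l \<Rightarrow> bool) \<Rightarrow> real ^ 'n \<Rightarrow> real ^ ('l + 'l)
    \<Rightarrow> real ^ ('m + ('l + 'l)) \<Rightarrow> 'l \<Rightarrow> bool" where
  "next_signature \<sigma> x s y =
     (if strong_stationary x s y then \<sigma>
      else (\<lambda>i. let v = switch_v x s y in
        if s $ Inl i = 0 \<and> s $ Inr i = 0 then
          (if \<sigma> i then \<not> (v (Inl i) \<le> 0 \<and> v (Inr i) < 0)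
           else v (Inr i) > 0 \<or> (v (Inr i) = 0 \<and> v (Inl i) > 0))
        else \<sigma> i))"

definition equilibrium ::
    "real ^ 'n \<Rightarrow> real ^ ('l + 'l) \<Rightarrow> real ^ ('m + ('l + 'l)) \<Rightarrow> bool" where
  "equilibrium x s y \<longleftrightarrow>
     (\<exists>\<sigma>. (x, s) \<in> C \<times> Cb \<sigma> \<and>
          flow_xs \<sigma> x s y = 0 \<and> flow_y x s y = 0 \<and>
          (\<forall>i. \<not> \<sigma> i \<longrightarrow> multiplier y (Inr (Inr i)) = 0) \<and>
          next_signature \<sigma> x s y = \<sigma>)"

end

end

theory Submission
  imports Defs
begin

text \<open>At a point with \<open>c(x, s) = 0\<close> the gradients of the Lagrangian and the augmented Lagrangian
  agree, and the negative partial derivative with respect to the slack \<open>s\<^sub>j\<close> is the multiplier of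
  the constraint containing \<open>s\<^sub>j\<close>.  Every branch \<open>C\<^sup>b(\<sigma>)\<close> is itself a box, so both notions amount to
  the same condition on \<open>x\<close> together with a sign condition on each multiplier, depending only on
  which bounds are active.  The sign conditions coincide for each \<open>i\<close> outside \<open>I\<^sub>0\<^sub>0\<close>; at a biactive
  pair the flow on the upper branch does not see directions with \<open>s\<^sub>i\<^sub>+\<^sub>l < 0\<close>, and the switching rule
  excludes exactly the additional multipliers that this would admit.\<close>

section \<open>Scalar products, gradients and projections\<close>

lemma inner_product_bounded_bilinear:
  fixes B :: "'a::euclidean_space \<Rightarrow> 'a \<Rightarrow> real"
  shows "inner_product B \<Longrightarrow> bounded_bilinear B"
  by (simp add: inner_product_def bilinear_conv_bounded_bilinear)

lemma inner_product_eq_0_iff: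
  assumes "inner_product B"
  shows "B u u = 0 \<longleftrightarrow> u = 0"
proof
  show "B u u = 0 \<Longrightarrow> u = 0"
    using assms unfolding inner_product_def by (metis less_irrefl)
  show "u = 0 \<Longrightarrow> B u u = 0"
    using assms unfolding inner_product_def by (simp add: bilinear_lzero)
qed

text \<open>Riesz representation for \<open>B\<close>: \<open>T\<close> turns \<open>B v\<close>
  into a vector for the standard inner product. Definiteness makes \<open>T\<close> injective, hence
  surjective in finite dimension.\<close>

lemma inner_product_representation:
  fixes B :: "'a::euclidean_space \<Rightarrow> 'a \<Rightarrow> real"
  assumes B: "inner_product B" and "linear L"
  shows "\<exists>v. \<forall>d. B v d = L d"
proof -
  interpret bounded_bilinear B using B by (rule inner_product_bounded_bilinear)
  define T where "T v = (\<Sum>b\<in>Basis. B v b *\<^sub>R b)" for v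
  have T: "T v \<bullet> d = B v d" for v d
  proof -
    have "T v \<bullet> d = (\<Sum>b\<in>Basis. (d \<bullet> b) * B v b)"
      by (simp add: T_def inner_sum_left inner_sum_right inner_commute[of _ d] mult.commute)
    also have "\<dots> = B v (\<Sum>b\<in>Basis. (d \<bullet> b) *\<^sub>R b)"
      by (simp add: sum_right scaleR_right)
    finally show ?thesis by (simp add: euclidean_representation)
  qed
  have lin: "linear T"
    by (rule linearI)
      (simp_all add: T_def add_left scaleR_left scaleR_left_distrib sum.distrib scaleR_sum_right)
  have "inj T"
    unfolding linear_injective_0[OF lin]
    by (metis T inner_zero_left inner_product_eq_0_iff[OF B])
  then have "surj T" using lin by (intro linear_inj_imp_surj)
  then obtain v where v: "T v = (\<Sum>b\<in>Basis. L b *\<^sub>R b)" by (metis surjD)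
  have "B v d = L d" for d
  proof -
    have "B v d = (\<Sum>b\<in>Basis. (d \<bullet> b) * L b)"
      unfolding T[symmetric] v by (simp add: inner_sum_left inner_sum_right inner_commute[of _ d] mult.commute)
    also have "\<dots> = L (\<Sum>b\<in>Basis. (d \<bullet> b) *\<^sub>R b)"
      using \<open>linear L\<close> by (simp add: linear_sum linear_cmul)
    finally show ?thesis by (simp add: euclidean_representation)
  qed
  then show ?thesis by blast
qed

text \<open>Makes the \<open>THE\<close> in \<open>gradient\<close> well defined: existence by the
  Riesz vector, uniqueness by definiteness. Later arguments need only a derivative, never the
  gradient vector itself.\<close>

lemma inner_product_gradient:
  assumes B: "inner_product B" and L: "(\<phi> has_derivative L) (at z)"
  shows "B (gradient B \<phi> z) d = L d"
proof -
  interpret bounded_bilinear B using B by (rule inner_product_bounded_bilinear)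
  obtain v where v: "\<And>d. B v d = L d"
    using inner_product_representation[OF B] has_derivative_linear[OF L] by blast
  have "gradient B \<phi> z = v"
    unfolding gradient_def
  proof (rule the_equality)
    show "(\<phi> has_derivative (\<lambda>d. B v d)) (at z)" using L by (simp add: v)
    fix w assume "(\<phi> has_derivative (\<lambda>d. B w d)) (at z)"
    then have "B w = L" using L by (rule has_derivative_unique)
    then have "B (w - v) (w - v) = 0" by (simp add: diff_left v)
    then show "w = v" by (simp add: inner_product_eq_0_iff[OF B])
  qed
  then show ?thesis by (simp add: v)
qed

text \<open>The minimum of \<open>B u u\<close> over the compact unit sphere is the constant;
  homogeneity of degree two carries the bound to all vectors.\<close>

lemma inner_product_coercive:
  fixes B :: "'a::euclidean_space \<Rightarrow> 'a \<Rightarrow> real"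
  assumes B: "inner_product B"
  obtains m where "0 < m" "\<And>u. m * (norm u)\<^sup>2 \<le> B u u"
proof -
  interpret bounded_bilinear B using B by (rule inner_product_bounded_bilinear)
  have "continuous_on (sphere 0 1) (\<lambda>u. B u u)"
    by (intro continuous_on continuous_on_id)
  then obtain w where w: "w \<in> sphere 0 1" "\<And>u. u \<in> sphere 0 1 \<Longrightarrow> B w w \<le> B u u"
    using continuous_attains_inf[of "sphere (0::'a) 1" "\<lambda>u. B u u"] by auto
  have "w \<noteq> 0" using w(1) by auto
  then have "0 < B w w" using B by (simp add: inner_product_def)
  moreover have "B w w * (norm u)\<^sup>2 \<le> B u u" for u
  proof (cases "u = 0")
    case False
    then have "B w w \<le> B (u /\<^sub>R norm u) (u /\<^sub>R norm u)" by (intro w(2)) simp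
    also have "\<dots> = B u u / (norm u)\<^sup>2"
      by (simp add: scaleR_left scaleR_right power2_eq_square divide_simps)
    finally show ?thesis using False by (simp add: pos_le_divide_eq)
  qed (simp add: zero_left)
  ultimately show thesis using that by blast
qed

text \<open>Coercivity bounds the part of \<open>M\<close> that is no farther from \<open>z\<close>
  than a fixed point \<open>a\<close>; this part is compact and so contains a nearest point.\<close>

lemma projection_exists:
  fixes B :: "'a::euclidean_space \<Rightarrow> 'a \<Rightarrow> real"
  assumes B: "inner_product B" and "closed M" "M \<noteq> {}"
  shows "\<exists>p\<in>M. \<forall>q\<in>M. B (z - p) (z - p) \<le> B (z - q) (z - q)"
proof -
  interpret bounded_bilinear B using B by (rule inner_product_bounded_bilinear)
  obtain m where m: "0 < m" "\<And>u. m * (norm u)\<^sup>2 \<le> B u u"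
    using inner_product_coercive[OF B] by blast
  obtain a where a: "a \<in> M" using \<open>M \<noteq> {}\<close> by blast
  define R where "R = B (z - a) (z - a)"
  define K where "K = M \<inter> {q. B (z - q) (z - q) \<le> R}"
  have cont: "continuous_on A (\<lambda>q. B (z - q) (z - q))" for A
    by (intro continuous_on continuous_intros)
  have "closed K"
    unfolding K_def using cont \<open>closed M\<close> by (intro closed_Int closed_Collect_le) auto
  moreover have "bounded K"
  proof (rule bounded_subset)
    show "K \<subseteq> cball z (sqrt (R / m))"
    proof
      fix q assume "q \<in> K"
      then have "m * (norm (z - q))\<^sup>2 \<le> R" using m(2)[of "z - q"] by (simp add: K_def)
      then have "(norm (z - q))\<^sup>2 \<le> R / m" using m(1) by (simp add: field_simps)
      then have "norm (z - q) \<le> sqrt (R / m)" by (simp add: real_le_rsqrt)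
      then show "q \<in> cball z (sqrt (R / m))" by (simp add: dist_norm)
    qed
  qed simp
  moreover have "a \<in> K" by (simp add: K_def a R_def)
  ultimately obtain p where p: "p \<in> K" "\<And>q. q \<in> K \<Longrightarrow> B (z - p) (z - p) \<le> B (z - q) (z - q)"
    using continuous_attains_inf[of K "\<lambda>q. B (z - q) (z - q)"] cont
    by (auto simp: compact_eq_bounded_closed)
  have "B (z - p) (z - p) \<le> B (z - q) (z - q)" if "q \<in> M" for q
    using p that by (cases "q \<in> K") (simp_all add: K_def)
  moreover have "p \<in> M" using p(1) by (simp add: K_def)
  ultimately show ?thesis by blast
qed

text \<open>Turns a vanishing projected flow into membership in a polar cone. Both directions rest
  on expanding \<open>B (z - q) (z - q)\<close>, whose linear term is
  \<open>- 2 * B z q\<close>.\<close>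

lemma projection_cone_eq_0_iff:
  fixes B :: "'a::euclidean_space \<Rightarrow> 'a \<Rightarrow> real"
  assumes B: "inner_product B" and K: "closed K" "cone K" "0 \<in> K"
  shows "projection B K z = 0 \<longleftrightarrow> (\<forall>d\<in>K. B z d \<le> 0)"
proof -
  interpret bounded_bilinear B using B by (rule inner_product_bounded_bilinear)
  have expand: "B (z - q) (z - q) = B z z - 2 * B z q + B q q" for q
    using B by (simp add: diff_left diff_right inner_product_def)
  let ?P = "\<lambda>p. p \<in> K \<and> (\<forall>q\<in>K. B (z - p) (z - p) \<le> B (z - q) (z - q))"
  have ex: "\<exists>p. ?P p" using projection_exists[OF B K(1)] K(3) by blast
  show ?thesis
  proof
    assume "projection B K z = 0"
    then have "?P 0" using someI_ex[OF ex] by (simp add: projection_def)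
    then have min: "B z z \<le> B (z - q) (z - q)" if "q \<in> K" for q using that by simp
    show "\<forall>d\<in>K. B z d \<le> 0"
    proof (rule ballI, rule ccontr)
      fix d assume d: "d \<in> K" "\<not> B z d \<le> 0"
      then have "d \<noteq> 0" by (auto simp: zero_right)
      then have pos: "0 < B d d" using B by (simp add: inner_product_def)
      \<comment> \<open>The minimiser of the squared distance to \<open>z\<close> along the ray
        through \<open>d\<close>; its point would be strictly closer to \<open>z\<close> than
        0.\<close>
      define t where "t = B z d / B d d"
      have t: "0 < t" using d pos by (simp add: t_def)
      have "t *\<^sub>R d \<in> K" using K(2) d t by (simp add: cone_def)
      from min[OF this] have "2 * t * B z d \<le> t * (t * B d d)"
        by (simp add: expand scaleR_left scaleR_right mult.assoc)
      also have "t * B d d = B z d" using pos by (simp add: t_def)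
      finally show False using t d by simp
    qed
  next
    assume polar: "\<forall>d\<in>K. B z d \<le> 0"
    show "projection B K z = 0"
      unfolding projection_def
    proof (rule some1_equality)
      \<comment> \<open>Strictness makes the nearest point unique, so the \<open>SOME\<close> in
        \<open>projection\<close> can only pick 0.\<close>
      have less: "B (z - 0) (z - 0) < B (z - q) (z - q)" if "q \<in> K" "q \<noteq> 0" for q
      proof -
        have "0 < B q q" using that B by (simp add: inner_product_def)
        then show ?thesis using polar that expand[of q] by fastforce
      qed
      show "?P 0" using less K(3) by force
      then show "\<exists>!p. ?P p" using less K(3) by (metis linorder_not_less)
    qed
  qed
qed

section \<open>Tangent cones of boxes\<close>

lemma tangent_coneI:
  assumes "eventually (\<lambda>t. z + t *\<^sub>R d \<in> M) (at_right 0)"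
  shows "d \<in> tangent_cone M z"
proof -
  obtain b :: real where b: "0 < b" "\<And>t. 0 < t \<Longrightarrow> t < b \<Longrightarrow> z + t *\<^sub>R d \<in> M"
    using assms by (auto simp: eventually_at_right_field)
  \<comment> \<open>The shift by 2 keeps \<open>t k\<close> strictly below \<open>b\<close> already
    at \<open>k = 0\<close>.\<close>
  define t where "t k = b / (real k + 2)" for k :: nat
  have "t \<longlonglongrightarrow> 0"
    unfolding t_def by real_asymp
  moreover have "0 < t k \<and> z + t k *\<^sub>R d \<in> M" for k
    using b(1) by (intro conjI b(2)) (auto simp: t_def divide_simps)
  ultimately show ?thesis
    unfolding tangent_cone_def by (intro CollectI exI[of _ t] exI[of _ "\<lambda>_. d"]) auto
qed

text \<open>Only this inclusion holds for general sets, as the two factors may require different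
  step sequences. For boxes the converse comes from straight rays.\<close>

lemma tangent_cone_Times_subset:
  "tangent_cone (M \<times> N) (u, v) \<subseteq> tangent_cone M u \<times> tangent_cone N v"
proof
  fix d assume "d \<in> tangent_cone (M \<times> N) (u, v)"
  then obtain t e where *: "\<And>k. 0 < t k" "\<And>k. (u, v) + t k *\<^sub>R e k \<in> M \<times> N"
    "(t :: nat \<Rightarrow> real) \<longlonglongrightarrow> 0" "e \<longlonglongrightarrow> d"
    unfolding tangent_cone_def by blast
  have "fst d \<in> tangent_cone M u"
    unfolding tangent_cone_def using * tendsto_fst[OF *(4)]
    by (intro CollectI exI[of _ t] exI[of _ "\<lambda>k. fst (e k)"]) (auto simp: mem_Times_iff)
  moreover have "snd d \<in> tangent_cone N v"
    unfolding tangent_cone_def using * tendsto_snd[OF *(4)]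
    by (intro CollectI exI[of _ t] exI[of _ "\<lambda>k. snd (e k)"]) (auto simp: mem_Times_iff)
  ultimately show "d \<in> tangent_cone M u \<times> tangent_cone N v" by (simp add: mem_Times_iff)
qed

text \<open>The tangent cone of a box at one of its points: only active bounds restrict a direction,
  and infinite bounds are never active.\<close>

definition box_directions :: "('i::finite \<Rightarrow> ereal) \<Rightarrow> ('i \<Rightarrow> ereal) \<Rightarrow> real ^ 'i \<Rightarrow> (real ^ 'i) set" where
  "box_directions lo up z =
     {d. \<forall>j. (lo j = ereal (z $ j) \<longrightarrow> 0 \<le> d $ j) \<and> (up j = ereal (z $ j) \<longrightarrow> d $ j \<le> 0)}"

lemma zero_in_box_directions: "0 \<in> box_directions lo up z"
  by (simp add: box_directions_def)

lemma cone_box_directions: "cone (box_directions lo up z)"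
  by (auto simp: cone_def box_directions_def mult_nonneg_nonpos)

lemma closed_box_directions: "closed (box_directions lo up z)"
  unfolding box_directions_def
  by (intro closed_Collect_all closed_Collect_conj closed_Collect_imp closed_Collect_le
      open_Collect_const continuous_intros)

text \<open>An active bound survives because \<open>d\<close> does not point outward; an inactive
  one stays strict for small \<open>t\<close> by continuity.\<close>

lemma eventually_lower_bound:
  assumes "lo \<le> ereal r" "lo = ereal r \<longrightarrow> 0 \<le> d"
  shows "eventually (\<lambda>t. lo \<le> ereal (r + t * d)) (at_right 0)"
proof (cases "lo = ereal r")
  case True
  then show ?thesis
    using assms(2) by (auto simp: eventually_at_right_field intro!: exI[of _ 1])
next
  case False
  then have "lo < ereal r" using assms(1) by simp
  moreover have "((\<lambda>t. ereal (r + t * d)) \<longlongrightarrow> ereal (r + 0 * d)) (at_right 0)"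
    by (intro tendsto_intros)
  ultimately have "eventually (\<lambda>t. lo < ereal (r + t * d)) (at_right 0)"
    by (intro order_tendstoD(1)[where y = "ereal r"]) auto
  then show ?thesis by eventually_elim simp
qed

lemma eventually_upper_bound:
  assumes "ereal r \<le> up" "up = ereal r \<longrightarrow> d \<le> 0"
  shows "eventually (\<lambda>t. ereal (r + t * d) \<le> up) (at_right 0)"
proof -
  have "- up = ereal (- r) \<longrightarrow> 0 \<le> - d"
    using assms(2) by (metis ereal_uminus_uminus uminus_ereal.simps(1) neg_0_le_iff_le)
  then have "eventually (\<lambda>t. - up \<le> ereal (- r + t * (- d))) (at_right 0)"
    using assms(1) by (intro eventually_lower_bound) (simp_all flip: uminus_ereal.simps(1))
  then show ?thesis
    by eventually_elim (metis add_uminus_conv_diff ereal_minus_le_minus minus_add_distrib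
        mult_minus_right uminus_ereal.simps(1))
qed

lemma eventually_in_box_set:
  assumes "z \<in> box_set lo up" "d \<in> box_directions lo up z"
  shows "eventually (\<lambda>t. z + t *\<^sub>R d \<in> box_set lo up) (at_right 0)"
  using assms unfolding box_set_def box_directions_def mem_Collect_eq
  by (intro eventually_all_finite eventually_conj)
    (auto intro!: eventually_lower_bound eventually_upper_bound)

text \<open>At an active bound every approximating \<open>e k\<close> already has the required sign,
  which passes to the limit.\<close>

lemma tangent_cone_box_set_subset: "tangent_cone (box_set lo up) z \<subseteq> box_directions lo up z"
proof
  fix d assume "d \<in> tangent_cone (box_set lo up) z"
  then obtain t e where *: "\<And>k. 0 < t k" "\<And>k. z + t k *\<^sub>R e k \<in> box_set lo up"
    "(t :: nat \<Rightarrow> real) \<longlonglongrightarrow> 0" "e \<longlonglongrightarrow> d"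
    unfolding tangent_cone_def by blast
  have lim: "(\<lambda>k. e k $ j) \<longlonglongrightarrow> d $ j" for j using *(4) by (rule tendsto_vec_nth)
  have "0 \<le> d $ j" if "lo j = ereal (z $ j)" for j
  proof (rule LIMSEQ_le_const[OF lim], intro exI allI impI)
    fix k show "0 \<le> e k $ j"
      using *(2)[of k] *(1)[of k] that by (auto simp: box_set_def zero_le_mult_iff dest: spec[of _ j])
  qed
  moreover have "d $ j \<le> 0" if "up j = ereal (z $ j)" for j
  proof (rule LIMSEQ_le_const2[OF lim], intro exI allI impI)
    fix k show "e k $ j \<le> 0"
      using *(2)[of k] *(1)[of k] that by (auto simp: box_set_def mult_le_0_iff dest: spec[of _ j])
  qed
  ultimately show "d \<in> box_directions lo up z" by (simp add: box_directions_def)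
qed

lemma tangent_cone_box_set_Times:
  assumes "u \<in> box_set lo up" "v \<in> box_set lo' up'"
  shows "tangent_cone (box_set lo up \<times> box_set lo' up') (u, v) =
    box_directions lo up u \<times> box_directions lo' up' v"
proof
  show "tangent_cone (box_set lo up \<times> box_set lo' up') (u, v)
      \<subseteq> box_directions lo up u \<times> box_directions lo' up' v"
    by (rule order_trans[OF tangent_cone_Times_subset Sigma_mono[OF tangent_cone_box_set_subset]])
      (rule tangent_cone_box_set_subset)
  show "box_directions lo up u \<times> box_directions lo' up' v
      \<subseteq> tangent_cone (box_set lo up \<times> box_set lo' up') (u, v)"
  proof clarify
    fix d d' assume "d \<in> box_directions lo up u" "d' \<in> box_directions lo' up' v"
    with assms show "(d, d') \<in> tangent_cone (box_set lo up \<times> box_set lo' up') (u, v)"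
      by (intro tangent_coneI) (auto intro!: eventually_conj eventually_in_box_set)
  qed
qed

text \<open>Membership of \<open>a\<close> in the normal cone of the interval from \<open>lo\<close>
  to \<open>up\<close> at a point \<open>r\<close> of it.\<close>

definition interval_normal :: "ereal \<Rightarrow> ereal \<Rightarrow> real \<Rightarrow> real \<Rightarrow> bool" where
  "interval_normal lo up r a \<longleftrightarrow> (a < 0 \<longrightarrow> lo = ereal r) \<and> (0 < a \<longrightarrow> up = ereal r)"

text \<open>A box restricts its coordinates independently, so the directions \<open>axis j 1\<close>
  and \<open>axis j (- 1)\<close> test each coefficient separately.\<close>

lemma box_directions_polar_iff:
  "(\<forall>d\<in>box_directions lo up z. (\<Sum>j\<in>UNIV. a j * d $ j) \<le> 0) \<longleftrightarrow>
     (\<forall>j. interval_normal (lo j) (up j) (z $ j) (a j))"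
proof
  assume polar: "\<forall>d\<in>box_directions lo up z. (\<Sum>j\<in>UNIV. a j * d $ j) \<le> 0"
  show "\<forall>j. interval_normal (lo j) (up j) (z $ j) (a j)"
  proof
    fix j
    have axis: "(\<Sum>k\<in>UNIV. a k * axis j r $ k) = a j * r" for r
      by (subst sum.remove[of _ j]) (auto simp: axis_def intro!: sum.neutral)
    have "a j * r \<le> 0" if "axis j r \<in> box_directions lo up z" for r
      using polar that by (metis axis)
    moreover have "axis j 1 \<in> box_directions lo up z" if "up j \<noteq> ereal (z $ j)"
      using that by (auto simp: box_directions_def axis_def)
    moreover have "axis j (- 1) \<in> box_directions lo up z" if "lo j \<noteq> ereal (z $ j)"
      using that by (auto simp: box_directions_def axis_def)
    ultimately show "interval_normal (lo j) (up j) (z $ j) (a j)"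
      by (fastforce simp: interval_normal_def)
  qed
next
  assume normal: "\<forall>j. interval_normal (lo j) (up j) (z $ j) (a j)"
  have "a j * d $ j \<le> 0" if "d \<in> box_directions lo up z" for d j
    using that normal[rule_format, of j]
    by (cases "a j" "0 :: real" rule: linorder_cases)
      (auto simp: interval_normal_def box_directions_def mult_le_0_iff)
  then show "\<forall>d\<in>box_directions lo up z. (\<Sum>j\<in>UNIV. a j * d $ j) \<le> 0"
    by (blast intro: sum_nonpos)
qed

lemma box_directions_Times_polar_iff:
  assumes "linear \<phi>"
  shows "(\<forall>(d, e)\<in>box_directions lo up u \<times> box_directions lo' up' v.
            \<phi> d + (\<Sum>j\<in>UNIV. a j * e $ j) \<le> 0) \<longleftrightarrow>
     (\<forall>d\<in>box_directions lo up u. \<phi> d \<le> 0) \<and> (\<forall>j. interval_normal (lo' j) (up' j) (v $ j) (a j))"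
    (is "?L \<longleftrightarrow> ?R")
proof
  assume L: ?L
  have "\<phi> d \<le> 0" if "d \<in> box_directions lo up u" for d
    using L[rule_format, of "(d, 0)"] that by (simp add: zero_in_box_directions)
  moreover have "(\<Sum>j\<in>UNIV. a j * e $ j) \<le> 0" if "e \<in> box_directions lo' up' v" for e
    using L[rule_format, of "(0, e)"] that by (simp add: zero_in_box_directions linear_0[OF assms])
  ultimately show ?R by (simp flip: box_directions_polar_iff)
next
  assume ?R
  then show ?L by (auto simp flip: box_directions_polar_iff intro: add_nonpos_nonpos)
qed

section \<open>The program with vanishing constraints\<close>

lemma twice_continuously_differentiable_imp_differentiable:
  "twice_continuously_differentiable h \<Longrightarrow> h differentiable (at x)"
  unfolding twice_continuously_differentiable_def differentiable_def by blast

text \<open>Collects the hypotheses in first-order form. The conditions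
  \<open>lower_bounds_inactive\<close> and \<open>biactive_upper_bounds\<close> on active slack
  bounds enter only in the final comparison.\<close>

locale smooth_mpvc = mpvc f g H G xl xu sl su ipX ipS ipY \<rho>
  for f :: "real ^ 'n::finite \<Rightarrow> real"
    and g :: "real ^ 'n \<Rightarrow> real ^ 'm::finite"
    and H G :: "'l::finite \<Rightarrow> real ^ 'n \<Rightarrow> real"
    and xl xu :: "'n \<Rightarrow> ereal"
    and sl su :: "'l + 'l \<Rightarrow> ereal"
    and ipX :: "real ^ 'n \<Rightarrow> real ^ 'n \<Rightarrow> real"
    and ipS :: "real ^ ('l + 'l) \<Rightarrow> real ^ ('l + 'l) \<Rightarrow> real"
    and ipY :: "real ^ ('m + ('l + 'l)) \<Rightarrow> real ^ ('m + ('l + 'l)) \<Rightarrow> real"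
    and \<rho> :: real +
  assumes ipX: "inner_product ipX" and ipS: "inner_product ipS" and ipY: "inner_product ipY"
    and f: "\<And>x. f differentiable (at x)"
    and g: "\<And>x. g differentiable (at x)"
    and H: "\<And>i x. H i differentiable (at x)"
    and G: "\<And>i x. G i differentiable (at x)"
    and sl_Inl: "\<And>i. sl (Inl i) = 0" and sl_Inr: "\<And>i. sl (Inr i) \<le> 0"
    and su_nonneg: "\<And>j. 0 \<le> su j"
begin

sublocale Y: bounded_bilinear ipY
  using ipY by (rule inner_product_bounded_bilinear)

lemma ipY_commute: "ipY u v = ipY v u"
  using ipY by (simp add: inner_product_def)

lemma inner_product_ipXS: "inner_product ipXS"
proof -
  interpret X: bounded_bilinear ipX using ipX by (rule inner_product_bounded_bilinear)
  interpret S: bounded_bilinear ipS using ipS by (rule inner_product_bounded_bilinear)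
  have nonneg: "0 \<le> ipX u u" "0 \<le> ipS v v" for u v
    using ipX ipS by (metis inner_product_def X.zero_left order_less_imp_le order_refl,
        metis inner_product_def S.zero_left order_less_imp_le order_refl)
  have "0 < ipXS z z" if "z \<noteq> 0" for z
  proof (cases "fst z = 0")
    case True
    then have "snd z \<noteq> 0" using that by (simp add: prod_eq_iff)
    then show ?thesis
      using nonneg(1) ipS unfolding ipXS_def inner_product_def by (simp add: add_nonneg_pos)
  next
    case False
    then show ?thesis
      using nonneg(2) ipX unfolding ipXS_def inner_product_def by (simp add: add_pos_nonneg)
  qed
  moreover have "bilinear ipXS"
    unfolding bilinear_def ipXS_def
    by (auto intro!: linearI simp: X.add_left X.add_right S.add_left S.add_right
        X.scaleR_left X.scaleR_right S.scaleR_left S.scaleR_right algebra_simps)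
  moreover have "ipXS u v = ipXS v u" for u v
    using ipX ipS by (simp add: inner_product_def ipXS_def)
  ultimately show ?thesis by (simp add: inner_product_def)
qed

section \<open>The constraint map and the derivatives of the Lagrangians\<close>

text \<open>Separates \<open>x\<close> from the slacks, which enter affinely; this makes all slack
  derivatives explicit.\<close>

lemma c_slack_decomposition: "c x s = c x 0 - (\<Sum>j\<in>UNIV. s $ j *\<^sub>R axis (Inr j) 1)"
proof (rule vec_eq_iff[THEN iffD2], rule allI)
  fix k :: "'m + ('l + 'l)"
  have "(\<Sum>j\<in>UNIV. s $ j * axis (Inr j) 1 $ k) = (case k of Inl _ \<Rightarrow> 0 | Inr j \<Rightarrow> s $ j)"
    by (cases k) (simp_all add: axis_def if_distrib cong: if_cong)
  then show "c x s $ k = (c x 0 - (\<Sum>j\<in>UNIV. s $ j *\<^sub>R axis (Inr j) 1)) $ k"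
    by (simp add: c_def split: sum.split)
qed

lemma c_differentiable: "(\<lambda>x. c x s) differentiable (at x)"
proof -
  have nth: "(\<lambda>x. g x $ k) differentiable (at x)" for k
    using g[of x] bounded_linear.has_derivative[OF bounded_linear_vec_nth]
    unfolding differentiable_def by blast
  have "(\<lambda>x. c x s $ j) differentiable (at x)" for j
    by (cases j rule: sum.exhaust[case_product sum.exhaust]; cases "projr j")
      (auto simp: c_def split: sum.split intro!: nth H G derivative_intros)
  then have "(\<lambda>x. \<Sum>j\<in>UNIV. c x s $ j *\<^sub>R axis j (1 :: real)) differentiable (at x)"
    by (intro derivative_intros ballI) auto
  moreover have "(\<Sum>j\<in>UNIV. v $ j *\<^sub>R axis j 1) = v" for v :: "real ^ ('m + ('l + 'l))"
    by (simp add: vec_eq_iff axis_def if_distrib cong: if_cong)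
  ultimately show ?thesis by simp
qed

lemma c_pair_differentiable: "(\<lambda>(x, s). c x s) differentiable (at (x, s))"
proof -
  have c0: "(\<lambda>z. c (fst z) 0) differentiable (at (x, s))"
    using c_differentiable[of 0 x]
      has_derivative_compose[OF bounded_linear_imp_has_derivative[OF bounded_linear_fst],
        of "\<lambda>x. c x 0" _ "(x, s)" UNIV]
    unfolding differentiable_def by auto
  have slack: "bounded_linear (\<lambda>z. \<Sum>j\<in>UNIV. snd z $ j *\<^sub>R axis (Inr j) 1
      :: real ^ ('m + ('l + 'l)))"
    by (intro bounded_linear_sum bounded_linear_scaleR_const
        bounded_linear_compose[OF bounded_linear_vec_nth bounded_linear_snd])
  show ?thesis
    unfolding case_prod_unfold
    by (subst c_slack_decomposition)
      (rule differentiable_diff[OF c0 bounded_linear_imp_differentiable[OF slack]])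
qed

lemma lagrangian_slack_decomposition:
  "lagrangian x s y = f x + ipY y (c x 0) - (\<Sum>j\<in>UNIV. multiplier y (Inr j) * s $ j)"
  unfolding lagrangian_def
  by (subst c_slack_decomposition)
    (simp add: multiplier_def Y.diff_right Y.sum_right Y.scaleR_right mult.commute)

text \<open>The slack is fixed at 0 because slacks contribute to the Lagrangian only a term constant
  in \<open>x\<close>.\<close>

definition x_derivative :: "real ^ 'n \<Rightarrow> real ^ ('m + ('l + 'l)) \<Rightarrow> real ^ 'n \<Rightarrow> real" where
  "x_derivative x y = frechet_derivative (\<lambda>x. f x + ipY y (c x 0)) (at x)"

lemma x_derivative: "((\<lambda>x. f x + ipY y (c x 0)) has_derivative x_derivative x y) (at x)"
proof -
  have "(\<lambda>x. ipY y (c x 0)) differentiable (at x)"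
    using c_differentiable[of 0 x] bounded_linear.has_derivative[OF Y.bounded_linear_right]
    unfolding differentiable_def by blast
  with f have "(\<lambda>x. f x + ipY y (c x 0)) differentiable (at x)"
    by (rule differentiable_add)
  then show ?thesis unfolding x_derivative_def by (simp add: frechet_derivative_works)
qed

lemma linear_x_derivative: "linear (x_derivative x y)"
  using has_derivative_linear[OF x_derivative] .

lemma lagrangian_has_derivative:
  "((\<lambda>(x, s). lagrangian x s y) has_derivative
     (\<lambda>(d, e). x_derivative x y d - (\<Sum>j\<in>UNIV. multiplier y (Inr j) * e $ j))) (at (x, s))"
proof -
  have "((\<lambda>z. f (fst z) + ipY y (c (fst z) 0)) has_derivative (\<lambda>z. x_derivative x y (fst z)))
      (at (x, s))"
    using has_derivative_compose[OF bounded_linear_imp_has_derivative[OF bounded_linear_fst],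
        of "\<lambda>x. f x + ipY y (c x 0)" "x_derivative x y" "(x, s)" UNIV] x_derivative
    by simp
  moreover have "bounded_linear (\<lambda>z. \<Sum>j\<in>UNIV. multiplier y (Inr j) * snd z $ j)"
    by (intro bounded_linear_sum bounded_linear_const_mult
        bounded_linear_compose[OF bounded_linear_vec_nth bounded_linear_snd])
  ultimately show ?thesis
    unfolding case_prod_unfold lagrangian_slack_decomposition
    by (intro has_derivative_diff bounded_linear_imp_has_derivative)
qed

text \<open>The penalty is quadratic in \<open>c\<close>, so by the product rule its derivative
  vanishes wherever \<open>c\<close> does, for every \<open>\<rho>\<close>.\<close>

lemma aug_lagrangian_has_derivative:
  assumes "c x s = 0"
  shows "((\<lambda>(x, s). aug_lagrangian x s y) has_derivative
     (\<lambda>(d, e). x_derivative x y d - (\<Sum>j\<in>UNIV. multiplier y (Inr j) * e $ j))) (at (x, s))"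
proof -
  obtain c' where c': "((\<lambda>z. c (fst z) (snd z)) has_derivative c') (at (x, s))"
    using c_pair_differentiable[of x s] unfolding differentiable_def case_prod_unfold by blast
  have "((\<lambda>z. \<rho> / 2 * ipY (c (fst z) (snd z)) (c (fst z) (snd z))) has_derivative (\<lambda>_. 0))
      (at (x, s))"
    using has_derivative_mult_right[OF Y.FDERIV[OF c' c'], of "\<rho> / 2"] assms
    by (simp add: Y.zero_left Y.zero_right)
  from has_derivative_add[OF lagrangian_has_derivative[of y x s] this] show ?thesis
    by (simp add: aug_lagrangian_def case_prod_unfold)
qed

text \<open>The common reduction: it serves strong stationarity on the box \<open>Cs\<close> with
  shifted multipliers, and equilibrium on the box \<open>Cb \<sigma>\<close> with the multipliers
  themselves.\<close>

lemma minus_gradient_polar_iff: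
  assumes "(\<psi> has_derivative (\<lambda>(d, e). \<phi> d - (\<Sum>j\<in>UNIV. a j * e $ j))) (at (x, s))" "linear \<phi>"
    and "x \<in> box_set lo up" "s \<in> box_set lo' up'"
  shows "- gradient ipXS \<psi> (x, s) \<in> polar_tangent_cone ipXS (box_set lo up \<times> box_set lo' up') (x, s)
     \<longleftrightarrow> (\<forall>d\<in>box_directions lo up x. 0 \<le> \<phi> d) \<and> (\<forall>j. interval_normal (lo' j) (up' j) (s $ j) (a j))"
proof -
  interpret bounded_bilinear ipXS
    using inner_product_ipXS by (rule inner_product_bounded_bilinear)
  have "ipXS (- gradient ipXS \<psi> (x, s)) (d, e) = - \<phi> d + (\<Sum>j\<in>UNIV. a j * e $ j)" for d e
    by (simp add: minus_left inner_product_gradient[OF inner_product_ipXS assms(1)])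
  then show ?thesis
    using box_directions_Times_polar_iff[of "\<lambda>d. - \<phi> d" lo up x lo' up' s a]
      linear_compose_neg[OF assms(2)]
    by (simp add: polar_tangent_cone_def tangent_cone_box_set_Times assms(3,4) case_prod_unfold)
qed

section \<open>Branches as boxes, and the flow and the switching vector at a point\<close>

definition branch_lower :: "('l \<Rightarrow> bool) \<Rightarrow> 'l + 'l \<Rightarrow> ereal" where
  "branch_lower \<sigma> j = (case j of Inl i \<Rightarrow> 0 | Inr i \<Rightarrow> if \<sigma> i then 0 else sl j)"

definition branch_upper :: "('l \<Rightarrow> bool) \<Rightarrow> 'l + 'l \<Rightarrow> ereal" where
  "branch_upper \<sigma> j = (if \<sigma> (case j of Inl i \<Rightarrow> i | Inr i \<Rightarrow> i) then su j else 0)"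

text \<open>Since \<open>sl (Inr i) \<le> 0\<close> and \<open>0 \<le> su j\<close>, each bound 0
  imposed by a branch is at least as tight as the bound of \<open>Cs\<close> that it
  replaces.\<close>

lemma Cb_eq_box_set: "Cb \<sigma> = box_set (branch_lower \<sigma>) (branch_upper \<sigma>)"
proof -
  have "s \<in> Cb \<sigma> \<longleftrightarrow> (\<forall>i. (branch_lower \<sigma> (Inl i) \<le> ereal (s $ Inl i) \<and>
       ereal (s $ Inl i) \<le> branch_upper \<sigma> (Inl i)) \<and>
       (branch_lower \<sigma> (Inr i) \<le> ereal (s $ Inr i) \<and> ereal (s $ Inr i) \<le> branch_upper \<sigma> (Inr i)))"
    (is "_ \<longleftrightarrow> (\<forall>i. ?B i)") for s
  proof -
    have "?B i \<longleftrightarrow> ((0 \<le> s $ Inl i \<and> ereal (s $ Inl i) \<le> su (Inl i)) \<and>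
        sl (Inr i) \<le> ereal (s $ Inr i) \<and> ereal (s $ Inr i) \<le> su (Inr i)) \<and>
        (if \<sigma> i then 0 \<le> s $ Inl i \<and> 0 \<le> s $ Inr i else s $ Inl i = 0 \<and> s $ Inr i \<le> 0)" for i
      using sl_Inr[of i] su_nonneg[of "Inl i"] su_nonneg[of "Inr i"]
        order_trans[of "sl (Inr i)" 0 "ereal (s $ Inr i)"]
        order_trans[of "ereal (s $ Inr i)" 0 "su (Inr i)"]
      by (auto simp: branch_lower_def branch_upper_def zero_ereal_def)
    then show ?thesis
      by (auto simp: Cb_def Cs_def box_set_def split_sum_all sl_Inl)
  qed
  then show ?thesis by (auto simp: box_set_def split_sum_all)
qed

lemma flow_xs_eq_0_iff:
  assumes "x \<in> C" "s \<in> Cb \<sigma>" "c x s = 0"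
  shows "flow_xs \<sigma> x s y = 0 \<longleftrightarrow>
    (\<forall>d\<in>box_directions xl xu x. 0 \<le> x_derivative x y d) \<and>
    (\<forall>j. interval_normal (branch_lower \<sigma> j) (branch_upper \<sigma> j) (s $ j) (multiplier y (Inr j)))"
proof -
  have "tangent_cone (C \<times> Cb \<sigma>) (x, s) =
      box_directions xl xu x \<times> box_directions (branch_lower \<sigma>) (branch_upper \<sigma>) s" (is "_ = ?K")
    using assms(1,2) unfolding C_def Cb_eq_box_set by (rule tangent_cone_box_set_Times)
  moreover have "closed ?K" by (intro closed_Times closed_box_directions)
  moreover have "cone ?K"
    using cone_box_directions[of xl xu x] cone_box_directions[of "branch_lower \<sigma>" "branch_upper \<sigma>" s]
    by (auto simp: cone_def)
  moreover have "0 \<in> ?K" by (simp add: zero_prod_def zero_in_box_directions)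
  ultimately have "flow_xs \<sigma> x s y = 0 \<longleftrightarrow>
      - gradient ipXS (\<lambda>(x, s). aug_lagrangian x s y) (x, s)
        \<in> polar_tangent_cone ipXS (C \<times> Cb \<sigma>) (x, s)"
    by (simp add: flow_xs_def projection_cone_eq_0_iff[OF inner_product_ipXS] polar_tangent_cone_def)
  also have "\<dots> \<longleftrightarrow> (\<forall>d\<in>box_directions xl xu x. 0 \<le> x_derivative x y d) \<and>
    (\<forall>j. interval_normal (branch_lower \<sigma> j) (branch_upper \<sigma> j) (s $ j) (multiplier y (Inr j)))"
    unfolding C_def Cb_eq_box_set
    using assms unfolding C_def Cb_eq_box_set
    by (intro minus_gradient_polar_iff aug_lagrangian_has_derivative linear_x_derivative)
  finally show ?thesis .
qed

text \<open>The augmented Lagrangian is affine in \<open>y\<close> with slope \<open>c x s\<close>,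
  the penalty being constant in \<open>y\<close>. Rest in \<open>y\<close> is thus equality
  feasibility.\<close>

lemma flow_y_eq: "flow_y x s y = c x s"
proof -
  have "((\<lambda>y. aug_lagrangian x s y) has_derivative (\<lambda>e. ipY e (c x s))) (at y)"
    unfolding aug_lagrangian_def lagrangian_def
    by (auto intro!: derivative_eq_intros bounded_linear_imp_has_derivative Y.bounded_linear_left)
  from inner_product_gradient[OF ipY this]
  have "ipY (flow_y x s y) d = ipY (c x s) d" for d
    by (simp add: flow_y_def ipY_commute)
  then have "ipY (flow_y x s y - c x s) (flow_y x s y - c x s) = 0"
    by (simp add: Y.diff_left)
  then show ?thesis
    by (simp add: inner_product_eq_0_iff[OF ipY])
qed

text \<open>Restricting the joint derivative to pure slack directions expresses the switching rule
  through multiplier signs, whatever the scalar product \<open>ipS\<close>.\<close>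

lemma switch_v_eq_multiplier:
  assumes "c x s = 0"
  shows "switch_v x s y j = multiplier y (Inr j)"
proof -
  interpret S: bounded_bilinear ipS using ipS by (rule inner_product_bounded_bilinear)
  have "((\<lambda>s'. (x, s')) has_derivative (\<lambda>e. (0, e))) (at s)"
    by (auto intro!: derivative_eq_intros)
  from has_derivative_compose[OF this aug_lagrangian_has_derivative[OF assms, of y]]
  have "((\<lambda>s'. aug_lagrangian x s' y) has_derivative
      (\<lambda>e. - (\<Sum>j\<in>UNIV. multiplier y (Inr j) * e $ j))) (at s)"
    by (simp add: linear_0[OF linear_x_derivative])
  from inner_product_gradient[OF ipS this, of "axis j 1"] show ?thesis
    by (simp add: switch_v_def S.minus_left axis_def if_distrib cong: if_cong)
qed

lemma c_eq_0_iff: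
  "c x s = 0 \<longleftrightarrow> g x = 0 \<and> (\<forall>i. H i x - s $ Inl i = 0 \<and> G i x - s $ Inr i = 0)"
  by (auto simp: vec_eq_iff c_def split_sum_all)

section \<open>Coordinatewise descriptions of strong stationarity and equilibrium\<close>

lemma lagrangian_relaxed_has_derivative:
  "((\<lambda>(x, s). lagrangian x s y + (\<Sum>i\<in>UNIV. \<eta>H i * s $ Inl i) + (\<Sum>i\<in>UNIV. \<eta>G i * s $ Inr i))
     has_derivative (\<lambda>(d, e). x_derivative x y d -
       (\<Sum>j\<in>UNIV. (multiplier y (Inr j) - case_sum \<eta>H \<eta>G j) * e $ j))) (at (x, s))"
proof -
  have sum: "(\<Sum>j\<in>UNIV. h j) = (\<Sum>i\<in>UNIV. h (Inl i)) + (\<Sum>i\<in>UNIV. h (Inr i))"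
    for h :: "'l + 'l \<Rightarrow> real"
    by (simp add: sum.Plus o_def flip: UNIV_Plus_UNIV)
  have "bounded_linear (\<lambda>z. \<Sum>j\<in>UNIV. case_sum \<eta>H \<eta>G j * snd z $ j)"
    by (intro bounded_linear_sum bounded_linear_const_mult
        bounded_linear_compose[OF bounded_linear_vec_nth bounded_linear_snd])
  from has_derivative_add[OF lagrangian_has_derivative[of y x s]
      bounded_linear_imp_has_derivative[OF this, of "at (x, s)"]]
  show ?thesis
    by (simp add: case_prod_unfold sum algebra_simps sum_subtractf)
qed

text \<open>Where a relaxation multiplier is constrained only by \<open>\<eta> \<le> 0\<close>, the best choice is the
  negative part of the multiplier it is subtracted from.\<close>

lemma strong_stationary_iff:
  "strong_stationary x s y \<longleftrightarrow> feasible x s \<and>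
     (\<forall>d\<in>box_directions xl xu x. 0 \<le> x_derivative x y d) \<and>
     (\<forall>i. (s $ Inr i < 0 \<or> interval_normal 0 (su (Inl i)) (s $ Inl i) (multiplier y (Inr (Inl i)))) \<and>
          interval_normal (if 0 < s $ Inl i then 0 else sl (Inr i)) (su (Inr i)) (s $ Inr i)
            (multiplier y (Inr (Inr i))))"
    (is "_ \<longleftrightarrow> _ \<and> ?X \<and> (\<forall>i. ?N i)")
proof (cases "feasible x s")
  case True
  let ?a = "\<lambda>i. multiplier y (Inr (Inl i))" and ?b = "\<lambda>i. multiplier y (Inr (Inr i))"
  let ?P = "\<lambda>\<eta>H \<eta>G i.
    interval_normal 0 (su (Inl i)) (s $ Inl i) (?a i - \<eta>H i) \<and>
    interval_normal (sl (Inr i)) (su (Inr i)) (s $ Inr i) (?b i - \<eta>G i) \<and>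
    (i \<in> Ip s \<longrightarrow> \<eta>H i = 0) \<and> (i \<in> I00 s \<union> I0p s \<longrightarrow> \<eta>H i \<le> 0) \<and>
    (i \<in> I0 s \<union> Ipp s \<longrightarrow> \<eta>G i = 0) \<and> (i \<in> Ip0 s \<longrightarrow> \<eta>G i \<le> 0)"
  note index_defs = Ip_def I0_def I00_def I0p_def I0m_def Ip0_def Ipp_def
  have sign [case_names positive zero]: thesis
    if positive: "0 < s $ Inl i \<Longrightarrow> 0 \<le> s $ Inr i \<Longrightarrow> thesis" and zero: "s $ Inl i = 0 \<Longrightarrow> thesis"
    for i thesis
  proof -
    have "0 \<le> s $ Inl i" "0 \<le> s $ Inr i * s $ Inl i" using True by (auto simp: feasible_def)
    then show thesis using that by (cases "s $ Inl i = 0") (auto simp: zero_le_mult_iff)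
  qed
  have box: "x \<in> box_set xl xu" "s \<in> box_set sl su"
    using True by (simp_all add: feasible_def C_def Cs_def)
  \<comment> \<open>Regrouping the conditions by index \<open>i\<close> lets
    \<open>\<eta>H i\<close> and \<open>\<eta>G i\<close> be chosen for each \<open>i\<close>
    independently.\<close>
  have components: "(\<forall>i. ?P \<eta>H \<eta>G i) \<longleftrightarrow>
      (\<forall>j. interval_normal (sl j) (su j) (s $ j) (multiplier y (Inr j) - case_sum \<eta>H \<eta>G j)) \<and>
      (\<forall>i\<in>Ip s. \<eta>H i = 0) \<and> (\<forall>i\<in>I00 s \<union> I0p s. \<eta>H i \<le> 0) \<and>
      (\<forall>i\<in>I0 s \<union> Ipp s. \<eta>G i = 0) \<and> (\<forall>i\<in>Ip0 s. \<eta>G i \<le> 0)" for \<eta>H \<eta>G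
    unfolding split_sum_all sum.case sl_Inl by blast
  have "strong_stationary x s y \<longleftrightarrow> ?X \<and> (\<exists>\<eta>H \<eta>G. \<forall>i. ?P \<eta>H \<eta>G i)"
    unfolding components strong_stationary_def C_def Cs_def
      minus_gradient_polar_iff[OF lagrangian_relaxed_has_derivative linear_x_derivative box]
    using True by blast
  also have "(\<exists>\<eta>H \<eta>G. \<forall>i. ?P \<eta>H \<eta>G i) \<longleftrightarrow> (\<forall>i. ?N i)"
  proof
    assume "\<exists>\<eta>H \<eta>G. \<forall>i. ?P \<eta>H \<eta>G i"
    then obtain \<eta>H \<eta>G where \<eta>: "?P \<eta>H \<eta>G i" for i by blast
    show "\<forall>i. ?N i"
    proof
      fix i
      from sign[of i] show "?N i"
      proof cases
        \<comment> \<open>At \<open>s $ Inr i = 0\<close>, the freedom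
          \<open>\<eta>G i \<le> 0\<close> admits negative multipliers exactly as an active lower
          bound 0 would; for \<open>s $ Inr i > 0\<close> neither 0 nor \<open>sl (Inr i)\<close> is
          active.\<close>
        case positive
        then show ?thesis
          using \<eta>[of i] sl_Inr[of i]
          by (cases "s $ Inr i = 0") (auto simp: index_defs interval_normal_def zero_ereal_def)
      next
        case zero
        then show ?thesis
          using \<eta>[of i]
          by (cases "s $ Inr i" "0 :: real" rule: linorder_cases)
            (auto simp: index_defs interval_normal_def zero_ereal_def)
      qed
    qed
  next
    assume N: "\<forall>i. ?N i"
    \<comment> \<open>On \<open>I0m\<close> the free \<open>\<eta>H i\<close> cancels the multiplier
      completely, whence the alternative \<open>s $ Inr i < 0\<close> in \<open>?N\<close>.\<close>
    have witness: "?P (\<lambda>i. if 0 < s $ Inl i then 0 else if s $ Inr i < 0 then ?a i else min 0 (?a i))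
      (\<lambda>i. if i \<in> Ip0 s then min 0 (?b i) else 0) i" for i
      using sign[of i]
    proof cases
      case positive
      then show ?thesis
        using N[rule_format, of i]
        by (cases "s $ Inr i = 0") (auto simp: index_defs interval_normal_def zero_ereal_def min_def)
    next
      case zero
      then show ?thesis
        using N[rule_format, of i]
        by (cases "s $ Inr i" "0 :: real" rule: linorder_cases)
          (auto simp: index_defs interval_normal_def zero_ereal_def min_def)
    qed
    show "\<exists>\<eta>H \<eta>G. \<forall>i. ?P \<eta>H \<eta>G i"
      by (rule exI, rule exI, rule allI, rule witness)
  qed
  finally show ?thesis using True by simp
qed (simp add: strong_stationary_def)

text \<open>On a lower branch \<open>s $ Inl i\<close> is pinned to 0, so its multiplier is
  unrestricted, and the zero multiplier of the omitted constraint satisfies any normality condition.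
  Only that zero condition remains.\<close>

lemma equilibrium_iff:
  "equilibrium x s y \<longleftrightarrow> x \<in> C \<and> c x s = 0 \<and>
     (\<forall>d\<in>box_directions xl xu x. 0 \<le> x_derivative x y d) \<and>
     (\<exists>\<sigma>. s \<in> Cb \<sigma> \<and> next_signature \<sigma> x s y = \<sigma> \<and>
       (\<forall>i. if \<sigma> i
            then interval_normal 0 (su (Inl i)) (s $ Inl i) (multiplier y (Inr (Inl i))) \<and>
                 interval_normal 0 (su (Inr i)) (s $ Inr i) (multiplier y (Inr (Inr i)))
            else multiplier y (Inr (Inr i)) = 0))"
proof -
  have branch: "interval_normal (branch_lower \<sigma> (Inl i)) (branch_upper \<sigma> (Inl i)) (s $ Inl i)
        (multiplier y (Inr (Inl i))) \<and>
      interval_normal (branch_lower \<sigma> (Inr i)) (branch_upper \<sigma> (Inr i)) (s $ Inr i)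
        (multiplier y (Inr (Inr i))) \<and>
      (\<not> \<sigma> i \<longrightarrow> multiplier y (Inr (Inr i)) = 0) \<longleftrightarrow>
      (if \<sigma> i
       then interval_normal 0 (su (Inl i)) (s $ Inl i) (multiplier y (Inr (Inl i))) \<and>
            interval_normal 0 (su (Inr i)) (s $ Inr i) (multiplier y (Inr (Inr i)))
       else multiplier y (Inr (Inr i)) = 0)" if "s \<in> Cb \<sigma>" for \<sigma> i
  proof -
    have "s $ Inl i = 0" if "\<not> \<sigma> i" using \<open>s \<in> Cb \<sigma>\<close> that by (auto simp: Cb_def split: if_splits)
    then show ?thesis
      by (auto simp: branch_lower_def branch_upper_def interval_normal_def zero_ereal_def)
  qed
  have branches: "(\<forall>j. interval_normal (branch_lower \<sigma> j) (branch_upper \<sigma> j) (s $ j) (multiplier y (Inr j))) \<and>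
      (\<forall>i. \<not> \<sigma> i \<longrightarrow> multiplier y (Inr (Inr i)) = 0) \<longleftrightarrow>
      (\<forall>i. if \<sigma> i
            then interval_normal 0 (su (Inl i)) (s $ Inl i) (multiplier y (Inr (Inl i))) \<and>
                 interval_normal 0 (su (Inr i)) (s $ Inr i) (multiplier y (Inr (Inr i)))
            else multiplier y (Inr (Inr i)) = 0)" if "s \<in> Cb \<sigma>" for \<sigma>
    unfolding branch[OF that, symmetric] split_sum_all by blast
  have "(x, s) \<in> C \<times> Cb \<sigma> \<and> flow_xs \<sigma> x s y = 0 \<and> c x s = 0 \<and>
      (\<forall>i. \<not> \<sigma> i \<longrightarrow> multiplier y (Inr (Inr i)) = 0) \<and> next_signature \<sigma> x s y = \<sigma> \<longleftrightarrow>
      x \<in> C \<and> c x s = 0 \<and> (\<forall>d\<in>box_directions xl xu x. 0 \<le> x_derivative x y d) \<and>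
      s \<in> Cb \<sigma> \<and> next_signature \<sigma> x s y = \<sigma> \<and>
      (\<forall>i. if \<sigma> i
            then interval_normal 0 (su (Inl i)) (s $ Inl i) (multiplier y (Inr (Inl i))) \<and>
                 interval_normal 0 (su (Inr i)) (s $ Inr i) (multiplier y (Inr (Inr i)))
            else multiplier y (Inr (Inr i)) = 0)" for \<sigma>
    using flow_xs_eq_0_iff[of x s \<sigma> y] branches[of \<sigma>] unfolding mem_Sigma_iff by argo
  then show ?thesis
    unfolding equilibrium_def flow_y_eq by simp
qed

end

section \<open>Comparison of the two sets of sign conditions, index by index\<close>

theorem theorem5p1:
  fixes f :: "real ^ 'n::finite \<Rightarrow> real"
    and g :: "real ^ 'n \<Rightarrow> real ^ 'm::finite"
    and H G :: "'l::finite \<Rightarrow> real ^ 'n \<Rightarrow> real"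
    and xl xu :: "'n \<Rightarrow> ereal"
    and sl su :: "'l + 'l \<Rightarrow> ereal"
    and ipX :: "real ^ 'n \<Rightarrow> real ^ 'n \<Rightarrow> real"
    and ipS :: "real ^ ('l + 'l) \<Rightarrow> real ^ ('l + 'l) \<Rightarrow> real"
    and ipY :: "real ^ ('m + ('l + 'l)) \<Rightarrow> real ^ ('m + ('l + 'l)) \<Rightarrow> real"
    and \<rho> :: real
    and x :: "real ^ 'n" and s :: "real ^ ('l + 'l)" and y :: "real ^ ('m + ('l + 'l))"
  assumes "inner_product ipX" and "inner_product ipS" and "inner_product ipY"
    and "0 \<le> \<rho>"
    and "twice_continuously_differentiable f"
    and "twice_continuously_differentiable g"
    and "\<And>i. twice_continuously_differentiable (H i)"
    and "\<And>i. twice_continuously_differentiable (G i)"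
    and "\<And>i. sl (Inl i) = 0" and "\<And>i. sl (Inr i) \<le> 0" and "\<And>j. 0 \<le> su j"
    and lower_bounds_inactive: "\<And>i. s $ Inr i < 0 \<Longrightarrow> sl (Inr i) < ereal (s $ Inr i)"
    and biactive_upper_bounds:
      "\<And>i. s $ Inl i = 0 \<Longrightarrow> s $ Inr i = 0 \<Longrightarrow> 0 < su (Inl i) \<or> sl (Inr i) = 0"
  shows "mpvc.strong_stationary f g H G xl xu sl su ipX ipS ipY x s y \<longleftrightarrow>
         mpvc.equilibrium f g H G xl xu sl su ipX ipS ipY \<rho> x s y"
proof -
  interpret smooth_mpvc f g H G xl xu sl su ipX ipS ipY \<rho>
    using assms by unfold_locales (auto intro: twice_continuously_differentiable_imp_differentiable)
  show ?thesis
  proof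
    assume SS: "strong_stationary x s y"
    \<comment> \<open>Biactive pairs go to the upper branch, where the bound 0 allows a negative
      multiplier of the \<open>G\<close> constraint; the lower branch would force it to be
      zero.\<close>
    define \<sigma> where "\<sigma> i \<longleftrightarrow> 0 \<le> s $ Inr i" for i
    have "feasible x s" using SS by (simp add: strong_stationary_def)
    then have feas: "x \<in> C" "s \<in> Cs" "c x s = 0" "\<And>i. 0 \<le> s $ Inl i" "\<And>i. 0 \<le> s $ Inr i * s $ Inl i"
      by (auto simp: feasible_def c_eq_0_iff)
    have mult_sign: "s $ Inl i = 0" if "s $ Inr i < 0" for i
      using feas(4,5)[of i] that by (simp add: zero_le_mult_iff)
    have "s \<in> Cb \<sigma>"
      using feas(2,4) mult_sign by (auto simp: Cb_def \<sigma>_def)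
    moreover have "next_signature \<sigma> x s y = \<sigma>" using SS by (simp add: next_signature_def)
    moreover have "if \<sigma> i
            then interval_normal 0 (su (Inl i)) (s $ Inl i) (multiplier y (Inr (Inl i))) \<and>
                 interval_normal 0 (su (Inr i)) (s $ Inr i) (multiplier y (Inr (Inr i)))
            else multiplier y (Inr (Inr i)) = 0" for i
    proof -
      have "(s $ Inr i < 0 \<or> interval_normal 0 (su (Inl i)) (s $ Inl i) (multiplier y (Inr (Inl i)))) \<and>
          interval_normal (if 0 < s $ Inl i then 0 else sl (Inr i)) (su (Inr i)) (s $ Inr i)
            (multiplier y (Inr (Inr i)))"
        using SS unfolding strong_stationary_iff by blast
      \<comment> \<open>For \<open>s $ Inr i < 0\<close> neither bound is active, by
        \<open>lower_bounds_inactive\<close> and \<open>0 \<le> su (Inr i)\<close>, so the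
        multiplier is zero. On the upper branch an active \<open>sl (Inr i)\<close> forces
        \<open>s $ Inr i = 0\<close>, where the branch bound is active too.\<close>
      then show ?thesis
        using mult_sign[of i] lower_bounds_inactive[of i] sl_Inr[of i] su_nonneg[of "Inr i"]
        by (auto simp: \<sigma>_def interval_normal_def zero_ereal_def not_less split: if_splits)
    qed
    ultimately show "equilibrium x s y"
      using SS feas(1,3) unfolding equilibrium_iff strong_stationary_iff by blast
  next
    assume E: "equilibrium x s y"
    show "strong_stationary x s y"
    \<comment> \<open>The switching test in \<open>next_signature\<close> is applied only at points
      that are not strong stationary, so the assumption is what yields information from the absence
      of a switch.\<close>
    proof (rule ccontr)
      assume "\<not> strong_stationary x s y"
      obtain \<sigma> where \<sigma>: "x \<in> C" "c x s = 0" "\<forall>d\<in>box_directions xl xu x. 0 \<le> x_derivative x y d"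
        "s \<in> Cb \<sigma>" "next_signature \<sigma> x s y = \<sigma>"
        and normal: "\<And>i. if \<sigma> i
            then interval_normal 0 (su (Inl i)) (s $ Inl i) (multiplier y (Inr (Inl i))) \<and>
                 interval_normal 0 (su (Inr i)) (s $ Inr i) (multiplier y (Inr (Inr i)))
            else multiplier y (Inr (Inr i)) = 0"
        using E unfolding equilibrium_iff by blast
      have no_switch: "\<sigma> i \<longleftrightarrow> (let v = switch_v x s y in
          if \<sigma> i then \<not> (v (Inl i) \<le> 0 \<and> v (Inr i) < 0)
          else v (Inr i) > 0 \<or> (v (Inr i) = 0 \<and> v (Inl i) > 0))"
        if "s $ Inl i = 0" "s $ Inr i = 0" for i
        using fun_cong[OF \<sigma>(5), of i] \<open>\<not> strong_stationary x s y\<close> that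
        by (simp add: next_signature_def Let_def split: if_splits)
      have branch: "if \<sigma> i then 0 \<le> s $ Inl i \<and> 0 \<le> s $ Inr i
          else s $ Inl i = 0 \<and> s $ Inr i \<le> 0" for i
        using \<sigma>(4) by (simp add: Cb_def)
      have "0 \<le> s $ Inl i \<and> 0 \<le> s $ Inr i * s $ Inl i" for i
        using branch[of i] by (auto split: if_splits)
      moreover have "s \<in> Cs" using \<sigma>(4) by (simp add: Cb_def)
      ultimately have "feasible x s"
        using \<sigma>(1,2) by (auto simp: feasible_def c_eq_0_iff)
      \<comment> \<open>Let \<open>a\<close> and \<open>b\<close> be the multipliers of the
        \<open>H\<close> and \<open>G\<close> constraints at a biactive pair. On the lower branch
        \<open>b = 0\<close>, and no switch gives \<open>a \<le> 0\<close>. On the upper branch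
        \<open>b < 0\<close> without a switch forces \<open>a > 0\<close>, hence
        \<open>su (Inl i) = 0\<close>, and \<open>biactive_upper_bounds\<close> makes
        \<open>sl (Inr i) = 0\<close> active.\<close>
      moreover have "(s $ Inr i < 0 \<or> interval_normal 0 (su (Inl i)) (s $ Inl i) (multiplier y (Inr (Inl i)))) \<and>
          interval_normal (if 0 < s $ Inl i then 0 else sl (Inr i)) (su (Inr i)) (s $ Inr i)
            (multiplier y (Inr (Inr i)))" for i
        using normal[of i] branch[of i] linorder_less_linear[of "s $ Inr i" 0] no_switch[of i]
          biactive_upper_bounds[of i]
        by (auto simp: switch_v_eq_multiplier[OF \<sigma>(2)] interval_normal_def zero_ereal_def not_less
            split: if_splits)
      ultimately show False
        using \<sigma>(3) \<open>\<not> strong_stationary x s y\<close> unfolding strong_stationary_iff by blast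
    qed
  qed
qed

end
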